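(* Let $X$ be a real Hilbert space, let $T\colon X\to X$ be firmly nonexpansive, let $A\colon X\rightrightarrows X$ be maximally monotone, and suppose that $T=J_A$, or equivalently that $A=T^{-1}-\mathrm{Id}$. Then the following are equivalent: (i) $T$ is surjective. (ii) $A$ has full domain, i.e., $\operatorname{dom}A=X$. (iii) $A^{-1}$ is surjective, i.e., $\operatorname{ran}A^{-1}=X$. Thus, for maximally monotone operators, surjectivity and full domain are properties that are dual to each other. These properties are not self-dual: e.g., $A=0$ has full domain while $A^{-1}=\partial\iota_{\{0\}}$ does not.
   Context: $X$ is a real Hilbert space; $\mathrm{Id}$ is the identity on $X$. $T\colon X\to X$ is firmly nonexpansive if $\|Tx-Ty\|^2+\|(\mathrm{Id}-T)x-(\mathrm{Id}-T)y\|^2\leq\|x-y\|^2$ for all $x,y\in X$. For $A\colon X\rightrightarrows X$ (so $Ax\subseteq X$ for each $x$): $\operatorname{gr}A=\{(x,u):u\in Ax\}$, $\operatorname{dom}A=\{x:Ax\neq\varnothing\}$, $\operatorname{ran}A=\bigcup_xAx$, and $x\in A^{-1}u\Leftrightarrow u\in Ax$. $A$ is monotone if $\langle x-y,u-v\rangle\geq0$ for all $(x,u),(y,v)\in\operatorname{gr}A$, and maximally monotone if it is monotone and has no proper monotone extension. The resolvent of a maximally monotone $A$ is $J_A=(\mathrm{Id}+A)^{-1}\colon X\to X$. $\partial\iota_{\{0\}}$ is the subdifferential of the indicator function of $\{0\}$, i.e., the operator with graph $\{0\}\times X$. Properties $(q)$ and $(q^* )$ of maximally monotone operators on $X$ are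 dual to each other if, for every maximally monotone $A\colon X\rightrightarrows X$, $A$ satisfies $(q)$ if and only if $A^{-1}$ satisfies $(q^* )$; $(q)$ is self-dual if $(q)=(q^* )$.
   Formalization: The claims that surjectivity and full domain are not self-dual, and that the inverse of A=0 does not have full domain, are stated for X ≠ {0}; they fail for X = {0}, where the subdifferential of the indicator of {0} has full domain. All else is for every real Hilbert space X. *)

theory Defs
  imports "HOL-Analysis.Analysis"
begin

type_synonym 'a operator = "'a \<Rightarrow> 'a set"

text \<open>A map \<open>T\<close> is identified with the set-valued operator \<open>x \<mapsto> {T x}\<close>.\<close>

definition operator_of :: "('a \<Rightarrow> 'a) \<Rightarrow> 'a operator" where
  "operator_of T = (\<lambda>x. {T x})"

definition operator_graph :: "'a operator \<Rightarrow> ('a \<times> 'a) set" where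
  "operator_graph A = {(x, u). u \<in> A x}"

definition operator_dom :: "'a operator \<Rightarrow> 'a set" where
  "operator_dom A = {x. A x \<noteq> {}}"

definition operator_ran :: "'a operator \<Rightarrow> 'a set" where
  "operator_ran A = (\<Union>x. A x)"

definition operator_inverse :: "'a operator \<Rightarrow> 'a operator" where
  "operator_inverse A = (\<lambda>u. {x. u \<in> A x})"

definition operator_add :: "'a::plus operator \<Rightarrow> 'a operator \<Rightarrow> 'a operator" where
  "operator_add A B = (\<lambda>x. {u + v | u v. u \<in> A x \<and> v \<in> B x})"

definition operator_diff :: "'a::minus operator \<Rightarrow> 'a operator \<Rightarrow> 'a operator" where
  "operator_diff A B = (\<lambda>x. {u - v | u v. u \<in> A x \<and> v \<in> B x})"

definition full_domain :: "'a operator \<Rightarrow> bool" where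
  "full_domain A \<longleftrightarrow> operator_dom A = UNIV"

definition surjective :: "'a operator \<Rightarrow> bool" where
  "surjective A \<longleftrightarrow> operator_ran A = UNIV"

definition firmly_nonexpansive :: "('a::real_inner \<Rightarrow> 'a) \<Rightarrow> bool" where
  "firmly_nonexpansive T \<longleftrightarrow>
    (\<forall>x y. (norm (T x - T y))\<^sup>2 + (norm ((x - T x) - (y - T y)))\<^sup>2 \<le> (norm (x - y))\<^sup>2)"

definition monotone_operator :: "'a::real_inner operator \<Rightarrow> bool" where
  "monotone_operator A \<longleftrightarrow>
    (\<forall>(x, u) \<in> operator_graph A. \<forall>(y, v) \<in> operator_graph A. 0 \<le> (x - y) \<bullet> (u - v))"

definition maximally_monotone :: "'a::real_inner operator \<Rightarrow> bool" where
  "maximally_monotone A \<longleftrightarrow> monotone_operator A \<and>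
    \<not> (\<exists>B. monotone_operator B \<and> operator_graph A \<subset> operator_graph B)"

text \<open>The resolvent is kept set-valued; that it is a map \<open>T\<close> is expressed by
  \<open>resolvent A = operator_of T\<close>.\<close>

definition resolvent :: "'a::real_inner operator \<Rightarrow> 'a operator" where
  "resolvent A = operator_inverse (operator_add (operator_of id) A)"

definition indicator_fun :: "'a set \<Rightarrow> 'a \<Rightarrow> ereal" where
  "indicator_fun C x = (if x \<in> C then 0 else \<infinity>)"

text \<open>Intended for proper \<open>f\<close>, for which it is empty wherever \<open>f x = \<infinity>\<close>.\<close>

definition subdifferential :: "('a::real_inner \<Rightarrow> ereal) \<Rightarrow> 'a operator" where
  "subdifferential f = (\<lambda>x. {u. \<forall>y. ereal ((y - x) \<bullet> u) + f x \<le> f y})"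

lemma graph_subdifferential_indicator_zero:
  "operator_graph (subdifferential (indicator_fun {0::'a::real_inner})) = {0} \<times> UNIV"
  by (auto simp: operator_graph_def subdifferential_def indicator_fun_def zero_ereal_def
      split: if_splits)

definition dual_properties ::
    "('a::real_inner operator \<Rightarrow> bool) \<Rightarrow> ('a operator \<Rightarrow> bool) \<Rightarrow> bool" where
  "dual_properties q q' \<longleftrightarrow>
    (\<forall>A. maximally_monotone A \<longrightarrow> (q A \<longleftrightarrow> q' (operator_inverse A)))"

definition self_dual :: "('a::real_inner operator \<Rightarrow> bool) \<Rightarrow> bool" where
  "self_dual q \<longleftrightarrow> dual_properties q q"

end

theory Submission
  imports Defs
begin

text \<open>Both \<open>T = J_A\<close> and \<open>A = T^{-1} - Id\<close> unfold to one pointwise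
  condition: \<open>v \<in> A x\<close> iff \<open>T (x + v) = x\<close>. This makes the two
  equivalent (\<open>resolvent_eq_operator_of_iff\<close>, \<open>eq_inverse_diff_id_iff\<close>)
  and gives dom A = ran T (\<open>operator_dom_eq_range\<close>), so T is onto exactly when A has
  full domain. Inversion transposes the graph and so swaps domain and range, which yields the
  remaining equivalence and the duality. The zero operator has domain X and range {0}; its inverse
  has these exchanged. As soon as X has a nonzero vector, {0} is not X, and this one operator
  refutes self-duality of both properties.\<close>

lemma mem_resolvent_iff: "x \<in> resolvent A u \<longleftrightarrow> u - x \<in> A x"
proof -
  have "x \<in> resolvent A u \<longleftrightarrow> (\<exists>v. u = x + v \<and> v \<in> A x)"
    by (simp add: resolvent_def operator_inverse_def operator_add_def operator_of_def)
  also have "\<dots> \<longleftrightarrow> u - x \<in> A x"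
    by (metis add_diff_cancel_left' add.commute diff_add_cancel)
  finally show ?thesis .
qed

text \<open>Substituting u = x + v in the description of the resolvent removes differences. The
  right-hand side is the common form to which A = T^{-1} - Id is also reduced.\<close>

lemma resolvent_eq_operator_of_iff:
  "resolvent A = operator_of T \<longleftrightarrow> (\<forall>x v. v \<in> A x \<longleftrightarrow> T (x + v) = x)"
proof -
  have "resolvent A = operator_of T \<longleftrightarrow> (\<forall>u x. u - x \<in> A x \<longleftrightarrow> T u = x)"
    by (auto simp: fun_eq_iff set_eq_iff mem_resolvent_iff operator_of_def)
  also have "\<dots> \<longleftrightarrow> (\<forall>x v. v \<in> A x \<longleftrightarrow> T (x + v) = x)"
    by (metis add_diff_cancel_left' add.commute diff_add_cancel)
  finally show ?thesis .
qed

lemma eq_inverse_diff_id_iff: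
  fixes A :: "'a::real_inner operator"
  shows "A = operator_diff (operator_inverse (operator_of T)) (operator_of id)
    \<longleftrightarrow> (\<forall>x v. v \<in> A x \<longleftrightarrow> T (x + v) = x)"
proof -
  have "v \<in> operator_diff (operator_inverse (operator_of T)) (operator_of id) x
      \<longleftrightarrow> T (x + v) = x" for x v
  proof -
    have "v \<in> operator_diff (operator_inverse (operator_of T)) (operator_of id) x
        \<longleftrightarrow> (\<exists>u. v = u - x \<and> T u = x)"
      by (auto simp: operator_diff_def operator_inverse_def operator_of_def)
    also have "\<dots> \<longleftrightarrow> T (x + v) = x"
      by (metis add_diff_cancel_left' add.commute diff_add_cancel)
    finally show ?thesis .
  qed
  then show ?thesis
    by (auto simp: fun_eq_iff set_eq_iff)
qed

lemma operator_ran_inverse [simp]: "operator_ran (operator_inverse A) = operator_dom A"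
  by (auto simp: operator_ran_def operator_inverse_def operator_dom_def)

lemma operator_dom_inverse [simp]: "operator_dom (operator_inverse A) = operator_ran A"
  by (auto simp: operator_ran_def operator_inverse_def operator_dom_def)

lemma operator_dom_eq_range:
  assumes "resolvent A = operator_of T"
  shows "operator_dom A = range T"
proof -
  have *: "v \<in> A x \<longleftrightarrow> T (x + v) = x" for x v
    using assms by (simp add: resolvent_eq_operator_of_iff)
  show ?thesis
  proof (intro set_eqI iffI)
    fix x assume "x \<in> operator_dom A"
    then show "x \<in> range T"
      by (metis (mono_tags, lifting) * operator_dom_def mem_Collect_eq ex_in_conv rangeI)
  next
    fix x assume "x \<in> range T"
    then obtain u where "x = T u" by blast
    \<comment> \<open>The pointwise condition applies because x + (u - x) = u and T u = x.\<close>
    then have "u - x \<in> A x" by (simp add: *)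
    then show "x \<in> operator_dom A" by (auto simp: operator_dom_def)
  qed
qed

lemma maximally_monotone_zero:
  "maximally_monotone (operator_of (\<lambda>_. 0 :: 'a::real_inner))"
proof -
  let ?Z = "operator_of (\<lambda>_. 0 :: 'a)"
  have "operator_graph B \<subseteq> operator_graph ?Z"
    if B: "monotone_operator B" "operator_graph ?Z \<subseteq> operator_graph B" for B
  proof clarify
    fix x u assume xu: "(x, u) \<in> operator_graph B"
    \<comment> \<open>The test point x + u is chosen so that monotonicity against (x, u) reads 0
      \<le> -(u \<bullet> u), forcing u = 0.\<close>
    have "(x + u, 0) \<in> operator_graph B"
      using B(2) by (auto simp: operator_graph_def operator_of_def)
    then have "0 \<le> (x - (x + u)) \<bullet> (u - 0)"
      using B(1) xu unfolding monotone_operator_def by fast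
    then have "u \<bullet> u \<le> 0" by simp
    then have "u = 0" by (metis inner_gt_zero_iff not_le)
    then show "(x, u) \<in> operator_graph ?Z"
      by (simp add: operator_graph_def operator_of_def)
  qed
  moreover have "monotone_operator ?Z"
    by (auto simp: monotone_operator_def operator_graph_def operator_of_def)
  ultimately show ?thesis
    unfolding maximally_monotone_def by blast
qed

text \<open>Transposing the graph X \<times> {0} gives {0} \<times> X, the known graph of the
  subdifferential.\<close>

lemma operator_inverse_zero:
  "operator_inverse (operator_of (\<lambda>_. 0 :: 'a::real_inner)) = subdifferential (indicator_fun {0})"
proof -
  have "u \<in> subdifferential (indicator_fun {0}) x \<longleftrightarrow> x = 0" for x u :: 'a
    using graph_subdifferential_indicator_zero by (auto simp: operator_graph_def set_eq_iff)
  then show ?thesis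
    by (auto simp: fun_eq_iff set_eq_iff operator_inverse_def operator_of_def)
qed

theorem theorem3p2:
  shows "(\<forall>(T :: 'a::{real_inner, complete_space} \<Rightarrow> 'a) (A :: 'a operator).
            firmly_nonexpansive T \<longrightarrow> maximally_monotone A \<longrightarrow>
              (resolvent A = operator_of T \<longleftrightarrow>
                A = operator_diff (operator_inverse (operator_of T)) (operator_of id)) \<and>
              (resolvent A = operator_of T \<longrightarrow>
                (surj T \<longleftrightarrow> full_domain A) \<and>
                (full_domain A \<longleftrightarrow> surjective (operator_inverse A)))) \<and>
         dual_properties (surjective :: 'a operator \<Rightarrow> bool) full_domain \<and>
         maximally_monotone (operator_of (\<lambda>_. 0 :: 'a)) \<and>
         full_domain (operator_of (\<lambda>_. 0 :: 'a)) \<and>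
         operator_inverse (operator_of (\<lambda>_. 0 :: 'a)) = subdifferential (indicator_fun {0}) \<and>
         ((\<exists>x :: 'a. x \<noteq> 0) \<longrightarrow>
           \<not> full_domain (subdifferential (indicator_fun {0 :: 'a})) \<and>
           \<not> self_dual (surjective :: 'a operator \<Rightarrow> bool) \<and>
           \<not> self_dual (full_domain :: 'a operator \<Rightarrow> bool))"
proof -
  let ?Z = "operator_of (\<lambda>_. 0 :: 'a)"
  have dom: "operator_dom ?Z = UNIV" and ran: "operator_ran ?Z = {0}"
    by (auto simp: operator_dom_def operator_ran_def operator_of_def)
  have "\<not> self_dual (surjective :: 'a operator \<Rightarrow> bool)"
    and "\<not> self_dual (full_domain :: 'a operator \<Rightarrow> bool)"
    and "\<not> full_domain (operator_inverse ?Z)" if "\<exists>x :: 'a. x \<noteq> 0"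
  proof -
    \<comment> \<open>The nonzero vector enters only here. The witness for both failures is
      \<open>?Z\<close>: it has full domain but is not surjective, while its inverse is surjective
      but lacks full domain.\<close>
    have "{0 :: 'a} \<noteq> UNIV" using that by blast
    then show "\<not> self_dual (surjective :: 'a operator \<Rightarrow> bool)"
      and "\<not> self_dual (full_domain :: 'a operator \<Rightarrow> bool)"
      and "\<not> full_domain (operator_inverse ?Z)"
      using maximally_monotone_zero dom ran
      by (auto simp: self_dual_def dual_properties_def surjective_def full_domain_def
          intro!: exI[of _ ?Z])
  qed
  \<comment> \<open>Using \<open>resolvent_eq_operator_of_iff\<close> from right to left folds the
    pointwise condition back into \<open>resolvent A = operator_of T\<close>, the premise under
    which \<open>operator_dom_eq_range\<close> rewrites the domain.\<close>
  then show ?thesis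
    using maximally_monotone_zero dom
    by (simp add: operator_inverse_zero resolvent_eq_operator_of_iff[symmetric]
        eq_inverse_diff_id_iff operator_dom_eq_range dual_properties_def
        surjective_def full_domain_def)
qed

end
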